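(* If the IJK algorithm is repeated three times (in succession on the same array $\mathtt{d}$, initialized by $\mathtt{d}[i,j]\leftarrow w(i,j)$ for all $i,j\in V$ before the first run only), it solves the all-pairs shortest path problem, i.e., afterwards $\mathtt{d}[i,j]$ stores the shortest path distance from $i$ to $j$ for all $i,j\in V$. Conversely, there exists an instance that needs three repeats of the IJK algorithm to obtain a correct solution, i.e., an instance for which two repeats do not give the shortest path distances for all pairs.
   Context: Let $G=(V,E)$ be a complete directed graph with vertex set $V=\{1,\dots,n\}$, and let $w\colon V\times V\to\mathbb{R}\cup\{\infty\}$ be the length of the edges. It is assumed that $G$ has no negative cycles. An instance consists of such a $G$ and $w$. The length of a path is the sum of the lengths of its edges, and the shortest path distance from one vertex to another is the length of a shortest path between them. The all-pairs shortest path problem asks for the shortest path distances for all $i,j\in V$. The IJK algorithm works on an $n\times n$ array $\mathtt{d}$, initialized by $\mathtt{d}[i,j]\leftarrow w(i,j)$ for all $i,j\in V$. One run consists of the following triply nested loops, updating $\mathtt{d}$ in place: for $i=1,2,\dots,n$ (outermost), for $j=1,2,\dots,n$ (middle), for $k=1,2,\dots,n$ (innermost), perform $\mathtt{d}[i,j]\leftarrow\min\{\mathtt{d}[i,j],\ \mathtt{d}[i,k]+\mathtt{d}[k,j]\}$. *)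

theory Defs
  imports "HOL-Library.Extended_Real"
begin

text \<open>
  An instance consists of the vertex set \<open>{1..n}\<close> and edge lengths \<open>w i j\<close> in the reals
  extended by \<open>\<infinity>\<close>. The lengths are functions into the extended reals of which only the
  values on \<open>{1..n}\<close> matter; there \<open>-\<infinity>\<close> is excluded in \<open>apsp_instance\<close>.

  A path is given by its sequence of vertices and has at least one edge; it may repeat
  vertices. The loop lengths \<open>w i i\<close> are not assumed to vanish and the algorithm starts
  with \<open>w i i\<close> on the diagonal, so the distance from \<open>i\<close> to itself is the length of a
  shortest closed path through \<open>i\<close>. In particular it is \<open>0\<close> whenever \<open>w i i = 0\<close>.
\<close>

definition vertices :: "nat \<Rightarrow> nat set" where
  "vertices n = {1..n}"

definition path :: "nat \<Rightarrow> nat \<Rightarrow> nat \<Rightarrow> nat list \<Rightarrow> bool" where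
  "path n i j p \<longleftrightarrow> 2 \<le> length p \<and> hd p = i \<and> last p = j \<and> set p \<subseteq> vertices n"

definition path_length :: "(nat \<Rightarrow> nat \<Rightarrow> ereal) \<Rightarrow> nat list \<Rightarrow> ereal" where
  "path_length w p = (\<Sum>(u, v)\<leftarrow>zip p (tl p). w u v)"

definition no_negative_cycles :: "nat \<Rightarrow> (nat \<Rightarrow> nat \<Rightarrow> ereal) \<Rightarrow> bool" where
  "no_negative_cycles n w \<longleftrightarrow> (\<forall>i p. path n i i p \<longrightarrow> 0 \<le> path_length w p)"

definition apsp_instance :: "nat \<Rightarrow> (nat \<Rightarrow> nat \<Rightarrow> ereal) \<Rightarrow> bool" where
  "apsp_instance n w \<longleftrightarrow>
     (\<forall>i\<in>vertices n. \<forall>j\<in>vertices n. w i j \<noteq> -\<infinity>) \<and> no_negative_cycles n w"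

definition shortest_path :: "nat \<Rightarrow> (nat \<Rightarrow> nat \<Rightarrow> ereal) \<Rightarrow> nat \<Rightarrow> nat \<Rightarrow> nat list \<Rightarrow> bool" where
  "shortest_path n w i j p \<longleftrightarrow>
     path n i j p \<and> (\<forall>q. path n i j q \<longrightarrow> path_length w p \<le> path_length w q)"

definition solves_apsp ::
    "nat \<Rightarrow> (nat \<Rightarrow> nat \<Rightarrow> ereal) \<Rightarrow> (nat \<Rightarrow> nat \<Rightarrow> ereal) \<Rightarrow> bool" where
  "solves_apsp n w d \<longleftrightarrow>
     (\<forall>i\<in>vertices n. \<forall>j\<in>vertices n. \<exists>p. shortest_path n w i j p \<and> d i j = path_length w p)"

definition update :: "nat \<Rightarrow> nat \<Rightarrow> nat \<Rightarrow> (nat \<Rightarrow> nat \<Rightarrow> ereal) \<Rightarrow> nat \<Rightarrow> nat \<Rightarrow> ereal" where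
  "update i j k d = d(i := (d i)(j := min (d i j) (d i k + d k j)))"

text \<open>\<open>fold\<close> processes the list from left to right, threading the array through as the state.\<close>

definition ijk :: "nat \<Rightarrow> (nat \<Rightarrow> nat \<Rightarrow> ereal) \<Rightarrow> nat \<Rightarrow> nat \<Rightarrow> ereal" where
  "ijk n =
     fold (\<lambda>i. fold (\<lambda>j. fold (\<lambda>k. update i j k) [1..<Suc n]) [1..<Suc n]) [1..<Suc n]"

end

theory Submission
  imports Defs
begin

text \<open>
  Entries only decrease and always dominate the length of some path, so it suffices to contract
  each path with distinct interior vertices to a single edge. When row \<open>i\<close> is processed, rows
  \<open>k < i\<close> and columns \<open>k < j\<close> are already final. The column order makes the first run contract
  the path to one whose labels first increase and then decrease. In the second run the column
  order contracts the increasing part to one edge and the row order the decreasing part. The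
  third run removes the peak.
\<close>

section \<open>One run of the algorithm\<close>

definition row_update :: "nat \<Rightarrow> nat \<Rightarrow> (nat \<Rightarrow> nat \<Rightarrow> ereal) \<Rightarrow> nat \<Rightarrow> nat \<Rightarrow> ereal" where
  "row_update n i = fold (\<lambda>j. fold (\<lambda>k. update i j k) [1..<Suc n]) [1..<Suc n]"

lemma ijk_eq_fold_row_update: "ijk n = fold (row_update n) [1..<Suc n]"
  by (simp add: ijk_def row_update_def[abs_def])

section \<open>Monotonicity and locality of the updates\<close>

lemma fold_le:
  fixes d :: "nat \<Rightarrow> nat \<Rightarrow> ereal"
  assumes "\<And>x d i j. f x d i j \<le> d i j"
  shows "fold f xs d i j \<le> d i j"
proof (induction xs arbitrary: d)
  case (Cons x xs)
  show ?case using Cons[of "f x d"] assms[of x d i j] by simp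
qed simp

lemma update_le: "update i j k d x y \<le> d x y"
  by (simp add: update_def)

lemma cell_le: "fold (\<lambda>k. update i j k) ks d x y \<le> d x y"
  by (rule fold_le) (rule update_le)

lemma row_le: "fold (\<lambda>j. fold (\<lambda>k. update i j k) ks) js d x y \<le> d x y"
  by (rule fold_le) (rule cell_le)

lemma row_update_le: "row_update n i d x y \<le> d x y"
  unfolding row_update_def by (rule row_le)

lemma rows_le: "fold (row_update n) is d x y \<le> d x y"
  by (rule fold_le) (rule row_update_le)

lemma ijk_le: "ijk n d x y \<le> d x y"
  unfolding ijk_eq_fold_row_update by (rule rows_le)

lemma cell_unchanged: "x \<noteq> i \<or> y \<noteq> j \<Longrightarrow> fold (\<lambda>k. update i j k) ks d x y = d x y"
  by (induction ks arbitrary: d) (auto simp: update_def)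

lemma row_unchanged:
  "x \<noteq> i \<or> y \<notin> set js \<Longrightarrow> fold (\<lambda>j. fold (\<lambda>k. update i j k) ks) js d x y = d x y"
  by (induction js arbitrary: d) (auto simp: cell_unchanged)

lemma row_update_unchanged: "x \<noteq> i \<Longrightarrow> row_update n i d x y = d x y"
  by (simp add: row_update_def row_unchanged)

lemma rows_unchanged: "x \<notin> set is \<Longrightarrow> fold (row_update n) is d x y = d x y"
  by (induction "is" arbitrary: d) (auto simp: row_update_unchanged)

section \<open>Relaxation inequalities for a cell, a row and a whole run\<close>

lemma upt_split_at:
  assumes "i \<in> {1..n}"
  shows "[1..<Suc n] = [1..<i] @ i # [Suc i..<Suc n]"
  using assms upt_add_eq_append[of 1 i "Suc n - i"] upt_conv_Cons[of i "Suc n"] by simp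

text \<open>Earlier passes of the innermost loop write only the entry at \<open>i\<close>,
  \<open>j\<close> and only lower it, so the bound obtained at step \<open>k\<close> survives with
  the initial values.\<close>

lemma cell_relaxed:
  assumes "k \<in> set ks"
  shows "fold (\<lambda>k. update i j k) ks d i j \<le> d i k + d k j"
  using assms
proof (induction ks arbitrary: d)
  case (Cons a ks)
  show ?case
  proof (cases "k = a")
    case True
    have "fold (\<lambda>k. update i j k) ks (update i j a d) i j \<le> update i j a d i j"
      by (rule cell_le)
    also have "\<dots> \<le> d i a + d a j"
      by (simp add: update_def)
    finally show ?thesis using True by simp
  next
    case False
    then have "fold (\<lambda>k. update i j k) (a # ks) d i j \<le> update i j a d i k + update i j a d k j"
      using Cons by simp
    also have "\<dots> \<le> d i k + d k j"
      by (intro add_mono update_le)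
    finally show ?thesis .
  qed
qed simp

text \<open>Columns are handled in increasing order, so at column \<open>j\<close> the entries of
  row \<open>i\<close> in columns \<open>k < j\<close> are already final.\<close>

lemma row_update_relaxed_inplace:
  assumes "j \<in> {1..n}" "k \<in> {1..n}"
  shows "row_update n i d i j \<le> (if k < j then row_update n i d i k else d i k) + d k j"
proof -
  let ?F = "fold (\<lambda>j. fold (\<lambda>k. update i j k) [1..<Suc n])"
  let ?d1 = "?F [1..<j] d"
  let ?d2 = "fold (\<lambda>k. update i j k) [1..<Suc n] ?d1"
  have row: "row_update n i d = ?F [Suc j..<Suc n] ?d2"
    unfolding row_update_def using assms by (subst upt_split_at[of j n]) simp_all
  have "row_update n i d i j \<le> ?d2 i j"
    unfolding row by (rule row_le)
  also have "\<dots> \<le> ?d1 i k + ?d1 k j"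
    using assms by (intro cell_relaxed) auto
  also have "\<dots> \<le> ?d1 i k + d k j"
    by (intro add_mono row_le order.refl)
  also have "?d1 i k = (if k < j then row_update n i d i k else d i k)"
    unfolding row by (auto simp: row_unchanged cell_unchanged)
  finally show ?thesis .
qed

lemma ijk_row:
  assumes "i \<in> {1..n}"
  shows "ijk n d i = row_update n i (fold (row_update n) [1..<i] d) i"
  unfolding ijk_eq_fold_row_update
  by (rule ext, subst upt_split_at[OF assms]) (simp add: rows_unchanged)

lemma ijk_before_row:
  assumes "i \<in> {1..n}" "k < i" "0 < k"
  shows "fold (row_update n) [1..<i] d k = ijk n d k"
  unfolding ijk_eq_fold_row_update
  using assms by (intro ext, subst upt_split_at[OF assms(1)])
    (simp add: rows_unchanged row_update_unchanged)

text \<open>Each row is written only in its own stage, so rows \<open>k < i\<close> are final when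
  row \<open>i\<close> is processed. Together with the column order, each summand takes its new
  value under its own condition.\<close>

lemma ijk_relaxed_inplace:
  assumes "i \<in> {1..n}" "j \<in> {1..n}" "k \<in> {1..n}"
  shows "ijk n d i j \<le> (if k < j then ijk n d i k else d i k) + (if k < i then ijk n d k j else d k j)"
proof -
  let ?e = "fold (row_update n) [1..<i] d"
  have "ijk n d i j \<le> (if k < j then ijk n d i k else ?e i k) + ?e k j"
    using row_update_relaxed_inplace[OF assms(2,3), of i ?e] by (simp only: ijk_row[OF assms(1)])
  also have "\<dots> \<le> (if k < j then ijk n d i k else d i k) + (if k < i then ijk n d k j else d k j)"
    using assms ijk_before_row[OF assms(1), of k] rows_le[of n "[1..<i]" d]
    by (intro add_mono) (simp_all del: One_nat_def)
  finally show ?thesis .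
qed

text \<open>Giving up the improvement of the other summand leaves a bound in which \<open>k\<close>
  is compared with one endpoint only.\<close>

lemma ijk_relaxed_column:
  assumes "i \<in> {1..n}" "j \<in> {1..n}" "k \<in> {1..n}" "k < j"
  shows "ijk n d i j \<le> ijk n d i k + d k j"
  using ijk_relaxed_inplace[OF assms(1-3), of d] assms(4)
  by (auto elim!: order_trans intro!: add_mono ijk_le)

lemma ijk_relaxed_row:
  assumes "i \<in> {1..n}" "j \<in> {1..n}" "k \<in> {1..n}" "k < i"
  shows "ijk n d i j \<le> d i k + ijk n d k j"
  using ijk_relaxed_inplace[OF assms(1-3), of d] assms(4)
  by (auto elim!: order_trans intro!: add_mono ijk_le)

lemma ijk_relaxed:
  assumes "i \<in> {1..n}" "j \<in> {1..n}" "k \<in> {1..n}"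
  shows "ijk n d i j \<le> d i k + d k j"
  by (rule order_trans[OF ijk_relaxed_inplace[OF assms, of d]]) (auto intro!: add_mono ijk_le)

section \<open>Three runs contract every path\<close>

text \<open>Positions are kept apart from labels to cover closed walks: only positions
  \<open>0\<close> and \<open>m\<close> may share a label.\<close>

lemma three_runs_le_walk:
  fixes v :: "nat \<Rightarrow> nat" and w :: "nat \<Rightarrow> nat \<Rightarrow> ereal"
  assumes m: "0 < m" and V: "\<And>a. a \<le> m \<Longrightarrow> v a \<in> {1..n}"
    and inj: "\<And>a b. a < b \<Longrightarrow> b \<le> m \<Longrightarrow> (a, b) \<noteq> (0, m) \<Longrightarrow> v a \<noteq> v b"
  shows "(ijk n ^^ 3) w (v 0) (v m) \<le> (\<Sum>t = 0..<m. w (v t) (v (Suc t)))"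
proof -
  define L where "L a b = (\<Sum>t = a..<b. w (v t) (v (Suc t)))" for a b
  define d where "d = ijk n w"
  define e where "e = ijk n d"
  \<comment> \<open>\<open>D\<close> and \<open>E\<close> express that the segment from position
    \<open>a\<close> to \<open>b\<close> is contracted to one edge after the first and second
    run.\<close>
  define D where "D a b \<longleftrightarrow> a < b \<and> b \<le> m \<and> d (v a) (v b) \<le> L a b" for a b
  define E where "E a b \<longleftrightarrow> a < b \<and> b \<le> m \<and> e (v a) (v b) \<le> L a b" for a b
  have L: "L a b + L b c = L a c" if "a < b" "b < c" for a b c
    using that by (simp add: L_def sum.atLeastLessThan_concat)
  have D_Suc: "D a (Suc a)" if "a < m" for a
    using that by (simp add: D_def L_def d_def ijk_le)
  have D_E: "E a b" if "D a b" for a b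
    using that order_trans[OF ijk_le] by (auto simp: D_def E_def e_def)
  \<comment> \<open>A valley \<open>b\<close>, lower than both neighbours, disappears in the first
    run, since both summands are new values.\<close>
  have D_trans: "D a c" if "D a b" "D b c" "v b < v a" "v b < v c" for a b c
  proof -
    have "d (v a) (v c) \<le> d (v a) (v b) + d (v b) (v c)"
      using ijk_relaxed_inplace[of "v a" n "v c" "v b" w] that V by (simp add: d_def D_def)
    also have "\<dots> \<le> L a b + L b c"
      using that by (intro add_mono) (auto simp: D_def)
    finally show ?thesis using that L[of a b c] by (simp add: D_def)
  qed
  \<comment> \<open>Row \<open>v b\<close> is final before row \<open>v a\<close>, whatever the
    label at \<open>c\<close>; \<open>E_column\<close> is the mirror image.\<close>
  have E_row: "E a c" if "D a b" "E b c" "v b < v a" for a b c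
  proof -
    have "e (v a) (v c) \<le> d (v a) (v b) + e (v b) (v c)"
      using ijk_relaxed_row[of "v a" n "v c" "v b" d] that V by (simp add: e_def D_def E_def)
    also have "\<dots> \<le> L a b + L b c"
      using that by (intro add_mono) (auto simp: D_def E_def)
    finally show ?thesis using that L[of a b c] by (simp add: D_def E_def)
  qed
  have E_column: "E a c" if "E a b" "D b c" "v b < v c" for a b c
  proof -
    have "e (v a) (v c) \<le> e (v a) (v b) + d (v b) (v c)"
      using ijk_relaxed_column[of "v a" n "v c" "v b" d] that V by (simp add: e_def D_def E_def)
    also have "\<dots> \<le> L a b + L b c"
      using that by (intro add_mono) (auto simp: D_def E_def)
    finally show ?thesis using that L[of a b c] by (simp add: D_def E_def)
  qed
  \<comment> \<open>The farthest position that one contracted edge reaches from \<open>a\<close>;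
    \<open>D_Suc\<close> makes the set nonempty for \<open>a < m\<close>.\<close>
  define s where "s a = Max {b. D a b}" for a
  have fin: "finite {b. D a b}" for a
    by (rule finite_subset[of _ "{..m}"]) (auto simp: D_def)
  have D_s: "D a (s a)" if "a < m" for a
    using Max_in[OF fin, of a] D_Suc[OF that] by (auto simp: s_def)
  have s_max: "b \<le> s a" if "D a b" for a b
    using Max_ge[OF fin, of b a] that by (simp add: s_def)
  \<comment> \<open>The greedy chain \<open>a, s a, s (s a), \<dots>\<close> is unimodal: once it descends, it descends for ever.\<close>
  have descent: "v (s (s a)) < v (s a)" if "a < m" "s a < m" "v (s a) < v a" for a
  proof (rule ccontr)
    assume "\<not> v (s (s a)) < v (s a)"
    moreover have "v (s a) \<noteq> v (s (s a))"
      using inj[of "s a" "s (s a)"] D_s[OF that(1)] D_s[OF that(2)] by (auto simp: D_def)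
    \<comment> \<open>Here \<open>s a\<close> would be a valley, so its removal would reach beyond
      the maximal position.\<close>
    ultimately have "D a (s (s a))"
      using D_trans[OF D_s[OF that(1)] D_s[OF that(2)]] that(3) by simp
    then show False
      using s_max[of a "s (s a)"] D_s[OF that(2)] by (simp add: D_def)
  qed
  \<comment> \<open>The descending chain is contracted from its far end, \<open>E_row\<close>
    prepending one edge at a time.\<close>
  have descending: "E a m" if "a < m" "v (s a) < v a" for a
    using that
  proof (induction "m - a" arbitrary: a rule: less_induct)
    case less
    have Ds: "D a (s a)" using D_s less.prems by simp
    show ?case
    proof (cases "s a < m")
      case True
      then have "E (s a) m"
        using less.hyps[of "s a"] descent[of a] less.prems Ds by (auto simp: D_def)
      then show ?thesis using E_row Ds less.prems by blast
    next
      case False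
      then show ?thesis using D_E Ds by (metis D_def le_neq_implies_less)
    qed
  qed
  \<comment> \<open>While the chain climbs, \<open>E_column\<close> appends its edges to a single
    edge from \<open>0\<close>. The witness \<open>b\<close> is the peak, where
    \<open>descending\<close> takes over.\<close>
  have ascending: "E 0 m \<or> (\<exists>b. E 0 b \<and> E b m)" if "E 0 a" "v 0 \<le> v a" for a
    using that
  proof (induction "m - a" arbitrary: a rule: less_induct)
    case less
    show ?case
    proof (cases "a < m")
      case True
      have Ds: "D a (s a)" using D_s True by simp
      then have ne: "v a \<noteq> v (s a)"
        using inj[of a "s a"] less.prems by (auto simp: D_def E_def)
      show ?thesis
      proof (cases "v (s a) < v a")
        case True
        then show ?thesis using descending \<open>a < m\<close> less.prems by blast
      next
        case False
        then have "E 0 (s a)" using E_column less.prems Ds ne by force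
        then show ?thesis
          using less.hyps[of "s a"] less.prems False Ds True by (auto simp: D_def)
      qed
    next
      case False
      then show ?thesis using less.prems by (metis E_def le_neq_implies_less)
    qed
  qed
  \<comment> \<open>The labels at \<open>0\<close> and \<open>s 0\<close> can agree only for a
    closed walk with \<open>s 0 = m\<close>; the weak inequality in \<open>ascending\<close> covers
    this case.\<close>
  have "E 0 m \<or> (\<exists>b. E 0 b \<and> E b m)"
    using descending[of 0] ascending[of "s 0"] D_E[OF D_s] m by fastforce
  then have "ijk n e (v 0) (v m) \<le> L 0 m"
  proof
    assume "E 0 m"
    then show ?thesis using order_trans[OF ijk_le] by (auto simp: E_def)
  next
    assume "\<exists>b. E 0 b \<and> E b m"
    then obtain b where b: "E 0 b" "E b m" by blast
    have "ijk n e (v 0) (v m) \<le> e (v 0) (v b) + e (v b) (v m)"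
      using b V by (intro ijk_relaxed) (auto simp: E_def)
    also have "\<dots> \<le> L 0 b + L b m"
      using b by (intro add_mono) (auto simp: E_def)
    finally show ?thesis using L b by (simp add: E_def)
  qed
  then show ?thesis by (simp add: L_def e_def d_def numeral_3_eq_3)
qed

section \<open>Path lengths\<close>

lemma path_length_singleton [simp]: "path_length w [x] = 0"
  by (simp add: path_length_def)

lemma path_length_Cons_Cons [simp]:
  "path_length w (x # y # xs) = w x y + path_length w (y # xs)"
  by (simp add: path_length_def)

lemma path_length_join:
  "path_length w (xs @ y # ys) = path_length w (xs @ [y]) + path_length w (y # ys)"
proof (induction xs)
  case (Cons x xs)
  then show ?case by (cases xs) (simp_all add: add.assoc)
qed simp

lemma path_length_eq_sum:
  "p \<noteq> [] \<Longrightarrow> path_length w p = (\<Sum>t = 0..<length p - 1. w (p ! t) (p ! Suc t))"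
proof (induction p)
  case (Cons x p)
  then show ?case
    by (cases p) (simp_all del: sum.op_ivl_Suc add: sum.atLeast0_lessThan_Suc_shift)
qed simp

text \<open>The side condition excludes cutting a closed path down to the single vertex
  \<open>y\<close>, which has no edge and hence is not a path.\<close>

lemma path_remove_cycle:
  assumes "no_negative_cycles n w" "path n i j (xs @ y # ys @ y # zs)" "xs \<noteq> [] \<or> zs \<noteq> []"
  shows "path n i j (xs @ y # zs)"
    and "path_length w (xs @ y # zs) \<le> path_length w (xs @ y # ys @ y # zs)"
proof -
  show "path n i j (xs @ y # zs)"
    using assms(2,3) by (cases xs; cases zs) (auto simp: path_def)
  have "path n y y (y # ys @ [y])"
    using assms(2) by (auto simp: path_def)
  then have cycle: "0 \<le> path_length w (y # ys @ [y])"
    using assms(1) by (simp add: no_negative_cycles_def)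
  have "path_length w (xs @ y # ys @ y # zs) =
      path_length w (xs @ [y]) + (path_length w (y # ys @ [y]) + path_length w (y # zs))"
    using path_length_join[of w xs y "ys @ y # zs"] path_length_join[of w "y # ys" y zs] by simp
  moreover have "path_length w (xs @ y # zs) = path_length w (xs @ [y]) + path_length w (y # zs)"
    by (rule path_length_join)
  ultimately show "path_length w (xs @ y # zs) \<le> path_length w (xs @ y # ys @ y # zs)"
    using cycle by (simp add: add_left_mono add_increasing)
qed

text \<open>The two distinctness conditions leave the first and last vertex free to coincide, as a
  closed path requires.\<close>

lemma path_shorten_to_distinct:
  assumes "no_negative_cycles n w" "path n i j p"
  shows "\<exists>q. path n i j q \<and> distinct (tl q) \<and> distinct (butlast q) \<and>
    path_length w q \<le> path_length w p"
  using assms(2)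
proof (induction p rule: length_induct)
  case (1 p)
  show ?case
  proof (cases "distinct (tl p) \<and> distinct (butlast p)")
    case True
    then show ?thesis using 1 by blast
  next
    case False
    have "p \<noteq> []" using 1 by (auto simp: path_def)
    \<comment> \<open>A repetition in \<open>butlast p\<close> leaves the last vertex behind it, one
      in \<open>tl p\<close> leaves the first vertex before it; so a path with an edge
      remains.\<close>
    have "\<exists>xs y ys zs. p = xs @ y # ys @ y # zs \<and> (xs \<noteq> [] \<or> zs \<noteq> [])"
    proof (cases "distinct (tl p)")
      case True
      then obtain xs y ys zs where "butlast p = xs @ [y] @ ys @ [y] @ zs"
        using False not_distinct_decomp by blast
      then have "p = xs @ y # ys @ y # (zs @ [last p])"
        using append_butlast_last_id[OF \<open>p \<noteq> []\<close>] by simp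
      then show ?thesis by blast
    next
      case False
      then obtain xs y ys zs where "tl p = xs @ [y] @ ys @ [y] @ zs"
        using not_distinct_decomp by blast
      then have "p = (hd p # xs) @ y # ys @ y # zs"
        using hd_Cons_tl[OF \<open>p \<noteq> []\<close>] by simp
      then show ?thesis by blast
    qed
    then obtain xs y ys zs where p: "p = xs @ y # ys @ y # zs" "xs \<noteq> [] \<or> zs \<noteq> []"
      by blast
    have "path n i j (xs @ y # zs)"
      and le: "path_length w (xs @ y # zs) \<le> path_length w p"
      using path_remove_cycle[OF assms(1)] 1(2) p by blast+
    moreover have "length (xs @ y # zs) < length p" using p by simp
    ultimately obtain q where "path n i j q" "distinct (tl q)" "distinct (butlast q)"
      "path_length w q \<le> path_length w (xs @ y # zs)"
      using 1(1) by blast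
    then show ?thesis using le order_trans by blast
  qed
qed

lemma three_runs_le_path_length:
  assumes "no_negative_cycles n w" "path n i j p"
  shows "(ijk n ^^ 3) w i j \<le> path_length w p"
proof -
  obtain q where q: "path n i j q" "distinct (tl q)" "distinct (butlast q)"
    and le: "path_length w q \<le> path_length w p"
    using path_shorten_to_distinct[OF assms] by blast
  define m where "m = length q - 1"
  have m: "0 < m" "length q = Suc m" "q \<noteq> []"
    using q(1) by (auto simp: m_def path_def)
  have V: "q ! a \<in> {1..n}" if "a \<le> m" for a
    using q(1) m that nth_mem[of a q] by (auto simp: path_def vertices_def simp del: nth_mem)
  \<comment> \<open>For \<open>a = 0\<close> both positions lie in \<open>butlast q\<close>;
    otherwise both lie in \<open>tl q\<close>, with indices shifted by one.\<close>
  have inj: "q ! a \<noteq> q ! b" if "a < b" "b \<le> m" "(a, b) \<noteq> (0, m)" for a b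
  proof (cases "a = 0")
    case True
    then show ?thesis
      using that m nth_eq_iff_index_eq[OF q(3), of a b] by (simp add: nth_butlast)
  next
    case False
    then show ?thesis
      using that m nth_eq_iff_index_eq[OF q(2), of "a - 1" "b - 1"] by (simp add: nth_tl)
  qed
  have "(ijk n ^^ 3) w (q ! 0) (q ! m) \<le> (\<Sum>t = 0..<m. w (q ! t) (q ! Suc t))"
    using m(1) V inj by (rule three_runs_le_walk)
  moreover have "q ! 0 = i" "q ! m = j"
    using q(1) m by (auto simp: path_def hd_conv_nth last_conv_nth)
  ultimately show ?thesis
    using path_length_eq_sum[OF m(3), of w] le by (simp add: m_def)
qed

section \<open>Entries are lengths of paths\<close>

definition bounded_by_paths ::
    "nat \<Rightarrow> (nat \<Rightarrow> nat \<Rightarrow> ereal) \<Rightarrow> (nat \<Rightarrow> nat \<Rightarrow> ereal) \<Rightarrow> bool" where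
  "bounded_by_paths n w d \<longleftrightarrow>
     (\<forall>i\<in>vertices n. \<forall>j\<in>vertices n. \<exists>p. path n i j p \<and> path_length w p \<le> d i j)"

text \<open>Paths may repeat vertices, so joining a path to \<open>k\<close> with one from
  \<open>k\<close> gives a path again.\<close>

lemma bounded_by_paths_update:
  assumes "bounded_by_paths n w d" "k \<in> vertices n"
  shows "bounded_by_paths n w (update i j k d)"
proof -
  have "\<exists>r. path n i j r \<and> path_length w r \<le> d i k + d k j"
    if ij: "i \<in> vertices n" "j \<in> vertices n"
  proof -
    obtain p q where p: "path n i k p" "path_length w p \<le> d i k"
      and q: "path n k j q" "path_length w q \<le> d k j"
      using assms ij unfolding bounded_by_paths_def by meson
    obtain p' where p': "p = p' @ [k]" "p' \<noteq> []"
      using p(1) by (cases p rule: rev_cases) (fastforce simp: path_def)+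
    obtain q' where q': "q = k # q'" "q' \<noteq> []"
      using q(1) by (cases q) (fastforce simp: path_def)+
    have "path n i j (p' @ k # q')"
      using p(1) q(1) p' q' by (cases p') (auto simp: path_def)
    moreover have "path_length w (p' @ k # q') \<le> d i k + d k j"
      using p(2) q(2) p' q' path_length_join[of w p' k q'] by (simp add: add_mono)
    ultimately show ?thesis by blast
  qed
  then show ?thesis
    using assms(1) by (auto simp: bounded_by_paths_def update_def min_def)
qed

lemma fold_invariant_set:
  assumes "\<And>x s. x \<in> set xs \<Longrightarrow> P s \<Longrightarrow> P (f x s)" "P s"
  shows "P (fold f xs s)"
  using assms by (induction xs arbitrary: s) auto

lemma bounded_by_paths_ijk:
  assumes "bounded_by_paths n w d"
  shows "bounded_by_paths n w (ijk n d)"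
  unfolding ijk_def
  by (intro fold_invariant_set[where P = "bounded_by_paths n w"] bounded_by_paths_update assms)
    (auto simp: vertices_def)

lemma bounded_by_paths_initial: "bounded_by_paths n w w"
  unfolding bounded_by_paths_def
proof (intro ballI)
  fix i j assume "i \<in> vertices n" "j \<in> vertices n"
  then show "\<exists>p. path n i j p \<and> path_length w p \<le> w i j"
    by (intro exI[of _ "[i, j]"]) (auto simp: path_def)
qed

text \<open>The path below the entry is itself bounded from below by the entry, which also bounds
  every other path; this proves that a shortest path exists.\<close>

lemma three_runs_solve_apsp:
  assumes "apsp_instance n w"
  shows "solves_apsp n w ((ijk n ^^ 3) w)"
  unfolding solves_apsp_def
proof (intro ballI)
  fix i j assume ij: "i \<in> vertices n" "j \<in> vertices n"
  let ?d = "(ijk n ^^ 3) w"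
  have upper: "?d i j \<le> path_length w q" if "path n i j q" for q
    using assms that by (intro three_runs_le_path_length) (simp_all add: apsp_instance_def)
  have "bounded_by_paths n w ?d"
    by (simp add: numeral_3_eq_3 bounded_by_paths_ijk bounded_by_paths_initial)
  then obtain p where p: "path n i j p" "path_length w p \<le> ?d i j"
    using ij unfolding bounded_by_paths_def by blast
  then have "?d i j = path_length w p" using upper by (simp add: antisym)
  then show "\<exists>p. shortest_path n w i j p \<and> ?d i j = path_length w p"
    using p upper by (auto simp: shortest_path_def)
qed

section \<open>An instance that needs three runs\<close>

text \<open>Lengths \<open>0\<close> and \<open>\<infinity>\<close> reduce distances to
  reachability, and the edge list makes the array finite data on which two runs can be
  evaluated.\<close>

definition zero_on :: "(nat \<times> nat) list \<Rightarrow> nat \<Rightarrow> nat \<Rightarrow> ereal" where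
  "zero_on es i j = (if (i, j) \<in> set es then 0 else \<infinity>)"

definition update_edges :: "nat \<Rightarrow> nat \<Rightarrow> nat \<Rightarrow> (nat \<times> nat) list \<Rightarrow> (nat \<times> nat) list" where
  "update_edges i j k es =
     (if (i, k) \<in> set es \<and> (k, j) \<in> set es then List.insert (i, j) es else es)"

definition ijk_edges :: "nat \<Rightarrow> (nat \<times> nat) list \<Rightarrow> (nat \<times> nat) list" where
  "ijk_edges n =
     fold (\<lambda>i. fold (\<lambda>j. fold (\<lambda>k. update_edges i j k) [1..<Suc n]) [1..<Suc n]) [1..<Suc n]"

lemma update_zero_on: "update i j k (zero_on es) = zero_on (update_edges i j k es)"
  by (auto simp: update_def zero_on_def update_edges_def fun_eq_iff)

text \<open>Lifts the simulation of a single update through the three nested loops.\<close>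

lemma fold_commute_map:
  assumes "\<And>x s. f x (h s) = h (g x s)"
  shows "fold f xs (h s) = h (fold g xs s)"
  by (induction xs arbitrary: s) (auto simp: assms)

lemma ijk_zero_on: "ijk n (zero_on es) = zero_on (ijk_edges n es)"
  unfolding ijk_def ijk_edges_def by (intro fold_commute_map update_zero_on)

lemma path_length_nonneg:
  assumes "\<And>i j. 0 \<le> w i j"
  shows "0 \<le> path_length w p"
  unfolding path_length_def using assms by (intro sum_list_nonneg) auto

lemma apsp_instance_zero_on: "apsp_instance n (zero_on es)"
proof -
  have "0 \<le> zero_on es i j" for i j by (simp add: zero_on_def)
  then have "0 \<le> path_length (zero_on es) p" for p by (rule path_length_nonneg)
  then show ?thesis
    by (simp add: apsp_instance_def no_negative_cycles_def zero_on_def)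
qed

text \<open>
  The first run contracts the path \<open>1, 2, 4, 3, 6, 7, 5\<close> only to \<open>1, 4, 7, 5\<close>, the second only to
  \<open>1, 7, 5\<close>.
\<close>

definition hard_edges :: "(nat \<times> nat) list" where
  "hard_edges = [(1,2), (2,4), (4,3), (3,6), (6,7), (7,5),
     (1,1), (2,2), (3,3), (4,4), (5,5), (6,6), (7,7)]"

lemma two_runs_miss_pair: "(1, 5) \<notin> set (ijk_edges 7 (ijk_edges 7 hard_edges))"
  by code_simp

text \<open>The full path from \<open>1\<close> to \<open>5\<close> has length \<open>0\<close>,
  whereas the entry is still \<open>\<infinity>\<close> after two runs.\<close>

lemma two_runs_fail: "\<not> solves_apsp 7 (zero_on hard_edges) ((ijk 7 ^^ 2) (zero_on hard_edges))"
proof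
  let ?w = "zero_on hard_edges" and ?q = "[1, 2, 4, 3, 6, 7, 5]"
  assume "solves_apsp 7 ?w ((ijk 7 ^^ 2) ?w)"
  then obtain p where p: "shortest_path 7 ?w 1 5 p" "(ijk 7 ^^ 2) ?w 1 5 = path_length ?w p"
    unfolding solves_apsp_def vertices_def by fastforce
  have "path 7 1 5 ?q" by (auto simp: path_def vertices_def)
  then have "path_length ?w p \<le> path_length ?w ?q"
    using p(1) unfolding shortest_path_def by blast
  also have "\<dots> = 0" by (simp add: zero_on_def hard_edges_def)
  finally have "(ijk 7 ^^ 2) ?w 1 5 \<le> 0" using p(2) by simp
  moreover have "(ijk 7 ^^ 2) ?w = zero_on (ijk_edges 7 (ijk_edges 7 hard_edges))"
    by (simp add: numeral_2_eq_2 ijk_zero_on)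
  ultimately show False using two_runs_miss_pair by (simp add: zero_on_def split: if_splits)
qed

theorem theorem1:
  shows "(\<forall>n w. apsp_instance n w \<longrightarrow> solves_apsp n w ((ijk n ^^ 3) w)) \<and>
         (\<exists>n w. apsp_instance n w \<and> (\<forall>i\<in>vertices n. w i i = 0) \<and>
            \<not> solves_apsp n w ((ijk n ^^ 2) w))"
proof (intro conjI exI allI impI)
  show "solves_apsp n w ((ijk n ^^ 3) w)" if "apsp_instance n w" for n w
    using that by (rule three_runs_solve_apsp)
  show "apsp_instance 7 (zero_on hard_edges)"
    by (rule apsp_instance_zero_on)
  show "\<forall>i\<in>vertices 7. zero_on hard_edges i i = 0"
    by (auto simp: vertices_def zero_on_def hard_edges_def)
  show "\<not> solves_apsp 7 (zero_on hard_edges) ((ijk 7 ^^ 2) (zero_on hard_edges))"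
    by (rule two_runs_fail)
qed

end
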